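(* Let $F\subset\mathbb{C}$ be a subfield and let $\mathfrak{g}$ be a finite-dimensional metric Lie algebra over $F$ with no non-zero abelian factor. There exist unique (up to ordering) irreducible factors $\mathfrak{g}_1,\dots,\mathfrak{g}_k\subset\mathfrak{g}$ such that $$\mathfrak{g}=\bigoplus_{j=1}^k \mathfrak{g}_j$$ is an orthogonal decomposition of $\mathfrak{g}$ into the ideals $\mathfrak{g}_j$. (Uniqueness is as ideals, i.e. as subsets of $\mathfrak{g}$, not merely up to isomorphism.)
   Context: All vector spaces and Lie algebras are finite-dimensional. A metric Lie algebra over a subfield $F\subset\mathbb{C}$ is a Lie algebra $\mathfrak{g}$ over $F$ equipped with a positive definite Hermitian form $\langle\cdot,\cdot\rangle:\mathfrak{g}\times\mathfrak{g}\to F$ (linear in the first and antilinear in the second argument), called the inner product; if $F\subset\mathbb{R}$ it is a symmetric bilinear form. A factor of $\mathfrak{g}$ is an ideal $\mathfrak{h}\subset\mathfrak{g}$ such that its orthogonal complement $\mathfrak{h}^\perp$ is also an ideal. Subalgebras, in particular factors, carry the restricted inner product. A non-zero metric Lie algebra is irreducible if each of its factors $\mathfrak{h}$ is either $0$ or the whole Lie algebra. "No non-zero abelian factor" means that no non-zero factor of $\mathfrak{g}$ is an abelian Lie algebra. An orthogonal decomposition is an internal direct sum of pairwise orthogonal ideals. *)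

theory Defs
  imports
    "HOL-Algebra.Algebraic_Closure_Type"
    "HOL-Algebra.Module"
    "HOL-Library.Multiset"
begin

text \<open>
  A metric Lie algebra is carried by a module record over the field \<open>scalars F\<close>, extended by
  a bracket and an inner product. The fields \<open>mult\<close> and \<open>one\<close>, which every module record inherits
  from ring records, are irrelevant. A subalgebra with the restricted inner product is obtained
  by replacing the carrier only.
\<close>

record 'v metric_lie = "(complex, 'v) module" +
  bracket :: "'v \<Rightarrow> 'v \<Rightarrow> 'v"
  inner :: "'v \<Rightarrow> 'v \<Rightarrow> complex"

definition scalars :: "complex set \<Rightarrow> complex ring" where
  "scalars F = ring_of_type_algebra\<lparr>carrier := F\<rparr>"

locale metric_lie_algebra = module "scalars F" g
  for F :: "complex set" and g :: "('v, 'e) metric_lie_scheme" (structure) +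
  assumes subfield: "subfield F (ring_of_type_algebra :: complex ring)"
    and bracket_closed:
      "\<lbrakk>x \<in> carrier g; y \<in> carrier g\<rbrakk> \<Longrightarrow> bracket g x y \<in> carrier g"
    and bracket_linear_left:
      "\<lbrakk>a \<in> F; b \<in> F; x \<in> carrier g; y \<in> carrier g; z \<in> carrier g\<rbrakk> \<Longrightarrow>
        bracket g (a \<odot> x \<oplus> b \<odot> y) z = a \<odot> bracket g x z \<oplus> b \<odot> bracket g y z"
    and bracket_linear_right:
      "\<lbrakk>a \<in> F; b \<in> F; x \<in> carrier g; y \<in> carrier g; z \<in> carrier g\<rbrakk> \<Longrightarrow>
        bracket g z (a \<odot> x \<oplus> b \<odot> y) = a \<odot> bracket g z x \<oplus> b \<odot> bracket g z y"
    and bracket_self: "x \<in> carrier g \<Longrightarrow> bracket g x x = \<zero>"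
    and jacobi:
      "\<lbrakk>x \<in> carrier g; y \<in> carrier g; z \<in> carrier g\<rbrakk> \<Longrightarrow>
        bracket g x (bracket g y z) \<oplus> bracket g y (bracket g z x)
          \<oplus> bracket g z (bracket g x y) = \<zero>"
    and inner_closed:
      "\<lbrakk>x \<in> carrier g; y \<in> carrier g\<rbrakk> \<Longrightarrow> inner g x y \<in> F"
    and inner_linear_left:
      "\<lbrakk>a \<in> F; b \<in> F; x \<in> carrier g; y \<in> carrier g; z \<in> carrier g\<rbrakk> \<Longrightarrow>
        inner g (a \<odot> x \<oplus> b \<odot> y) z = a * inner g x z + b * inner g y z"
    and inner_antilinear_right:
      "\<lbrakk>a \<in> F; b \<in> F; x \<in> carrier g; y \<in> carrier g; z \<in> carrier g\<rbrakk> \<Longrightarrow>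
        inner g z (a \<odot> x \<oplus> b \<odot> y) = cnj a * inner g z x + cnj b * inner g z y"
    and inner_hermitian:
      "\<lbrakk>x \<in> carrier g; y \<in> carrier g\<rbrakk> \<Longrightarrow> inner g y x = cnj (inner g x y)"
    and inner_pos:
      "\<lbrakk>x \<in> carrier g; x \<noteq> \<zero>\<rbrakk> \<Longrightarrow> inner g x x \<in> \<real> \<and> 0 < Re (inner g x x)"

definition finite_dim :: "complex set \<Rightarrow> ('v, 'e) metric_lie_scheme \<Rightarrow> bool" where
  "finite_dim F g \<longleftrightarrow>
    (\<exists>B. finite B \<and> B \<subseteq> carrier g \<and>
      (\<forall>x\<in>carrier g. \<exists>c\<in>B \<rightarrow> F. x = (\<Oplus>\<^bsub>g\<^esub>b\<in>B. c b \<odot>\<^bsub>g\<^esub> b)))"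

definition lie_ideal :: "complex set \<Rightarrow> ('v, 'e) metric_lie_scheme \<Rightarrow> 'v set \<Rightarrow> bool" where
  "lie_ideal F g h \<longleftrightarrow>
    submodule h (scalars F) g \<and> (\<forall>x\<in>carrier g. \<forall>y\<in>h. bracket g x y \<in> h)"

definition orth_compl :: "('v, 'e) metric_lie_scheme \<Rightarrow> 'v set \<Rightarrow> 'v set" where
  "orth_compl g h = {x \<in> carrier g. \<forall>y\<in>h. inner g x y = 0}"

definition lie_factor :: "complex set \<Rightarrow> ('v, 'e) metric_lie_scheme \<Rightarrow> 'v set \<Rightarrow> bool" where
  "lie_factor F g h \<longleftrightarrow> lie_ideal F g h \<and> lie_ideal F g (orth_compl g h)"

definition abelian_lie :: "('v, 'e) metric_lie_scheme \<Rightarrow> bool" where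
  "abelian_lie g \<longleftrightarrow> (\<forall>x\<in>carrier g. \<forall>y\<in>carrier g. bracket g x y = \<zero>\<^bsub>g\<^esub>)"

definition irreducible_lie :: "complex set \<Rightarrow> ('v, 'e) metric_lie_scheme \<Rightarrow> bool" where
  "irreducible_lie F g \<longleftrightarrow>
    carrier g \<noteq> {\<zero>\<^bsub>g\<^esub>} \<and> (\<forall>h. lie_factor F g h \<longrightarrow> h = {\<zero>\<^bsub>g\<^esub>} \<or> h = carrier g)"

text \<open>
  The internal direct sum condition says that every vector is \<open>f 0 + \<dots> + f (k - 1)\<close> for
  exactly one family with \<open>f i\<close> in the \<open>i\<close>-th ideal; the empty list decomposes the zero algebra.
\<close>

definition orthogonal_decomposition ::
    "complex set \<Rightarrow> ('v, 'e) metric_lie_scheme \<Rightarrow> 'v set list \<Rightarrow> bool" where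
  "orthogonal_decomposition F g hs \<longleftrightarrow>
    (\<forall>i<length hs. lie_ideal F g (hs ! i)) \<and>
    (\<forall>i<length hs. \<forall>j<length hs. i \<noteq> j \<longrightarrow>
      (\<forall>x\<in>hs ! i. \<forall>y\<in>hs ! j. inner g x y = 0)) \<and>
    (\<forall>x\<in>carrier g. \<exists>!f. f \<in> (\<Pi>\<^sub>E i\<in>{..<length hs}. hs ! i) \<and>
      x = (\<Oplus>\<^bsub>g\<^esub>i\<in>{..<length hs}. f i))"

definition irreducible_factor_decomposition ::
    "complex set \<Rightarrow> ('v, 'e) metric_lie_scheme \<Rightarrow> 'v set list \<Rightarrow> bool" where
  "irreducible_factor_decomposition F g hs \<longleftrightarrow>
    (\<forall>h\<in>set hs. lie_factor F g h \<and> irreducible_lie F (g\<lparr>carrier := h\<rparr>)) \<and>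
    orthogonal_decomposition F g hs"

end

theory Submission
  imports Defs "HOL-Library.Function_Algebras"
begin

text \<open>
  The irreducible factors of \<open>g\<close> turn out to be exactly the minimal non-zero factors, here called
  atoms, and the only decomposition lists each atom once. So uniqueness is immediate from a
  description of the decomposition that involves no choice.

  Two facts make this work. The first is that the factors behave like a lattice with complements:
  in finite dimension a subspace is the complement of its complement (\<open>orth_compl_orth_compl\<close>), so
  the complement of a factor is a factor, and a subspace is a factor if and only if it is invariant
  under all the maps \<open>bracket g x _\<close> and their adjoints, so any intersection of factors is a factor
  (\<open>Inter_factor\<close>). Moreover the factors of a factor \<open>h\<close> are the factors of \<open>g\<close> inside \<open>h\<close>
  (\<open>factor_restrict\<close>).

  The second is that, without non-zero abelian factors, an atom lies in any given factor or in its
  orthogonal complement (\<open>atom_below_factor_or_orth_compl\<close>), as an atom \<open>h\<close> meeting both trivially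
  would satisfy \<open>[h, g] = 0\<close>. In an abelian algebra of dimension at least two this
  fails: every line is an atom, and may be neither equal nor orthogonal to another line.

  Consequently distinct atoms are orthogonal, there are finitely many of them, and the factor of all
  vectors orthogonal to every atom is zero since it contains no atom. Hence the atoms give an
  orthogonal decomposition. Conversely, any decomposition into irreducible factors consists of
  atoms, and an atom not among them would be orthogonal to the whole of \<open>g\<close>.
\<close>

section \<open>Arithmetic in a metric Lie algebra\<close>

lemma scalars_simps [simp]:
  "carrier (scalars F) = F" "add (scalars F) = (+)" "monoid.mult (scalars F) = (*)"
  "zero (scalars F) = 0" "one (scalars F) = 1"
  by (simp_all add: scalars_def ring_of_type_algebra_def)

context metric_lie_algebra
begin

lemma scalar_zero [simp]: "0 \<in> F"
  using R.zero_closed by simp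

lemma scalar_one [simp]: "1 \<in> F"
  using R.one_closed by simp

lemma scalar_minus [simp]: "a \<in> F \<Longrightarrow> - a \<in> F"
proof -
  assume a: "a \<in> F"
  have "\<ominus>\<^bsub>scalars F\<^esub> a = - a"
    using R.l_neg[of a] a by (simp add: eq_neg_iff_add_eq_0)
  then show ?thesis
    using R.a_inv_closed[of a] a by simp
qed

lemma scalar_mult [simp]: "a \<in> F \<Longrightarrow> b \<in> F \<Longrightarrow> a * b \<in> F"
  using R.m_closed[of a b] by simp

lemma scalar_divide [simp]:
  assumes "a \<in> F" "b \<in> F"
  shows "a / b \<in> F"
proof (cases "b = 0")
  case False
  interpret K: field "ring_of_type_algebra :: complex ring"
    by (rule field_from_type_algebra)
  let ?K = "ring_of_type_algebra :: complex ring"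
  have K: "monoid.mult ?K = (*)" "one ?K = 1" "zero ?K = 0"
    by (simp_all add: ring_of_type_algebra_def)
  have b: "b \<in> F - {\<zero>\<^bsub>?K\<^esub>}"
    using assms False K by simp
  have "inv\<^bsub>?K\<^esub> b \<in> F" "b * inv\<^bsub>?K\<^esub> b = 1"
    using K.subfield_m_inv(1,2)[OF subfield b] K by auto
  then have "inverse b \<in> F"
    by (metis inverse_unique)
  then show ?thesis
    using assms by (simp add: divide_inverse)
qed simp

lemma smult_in [simp]: "a \<in> F \<Longrightarrow> x \<in> carrier g \<Longrightarrow> a \<odot> x \<in> carrier g"
  using smult_closed by simp

lemma smult_1 [simp]: "x \<in> carrier g \<Longrightarrow> 1 \<odot> x = x"
  using smult_one by simp

lemma smult_0 [simp]: "x \<in> carrier g \<Longrightarrow> 0 \<odot> x = \<zero>"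
  using smult_l_null by simp

lemma minus_eq_smult: "x \<in> carrier g \<Longrightarrow> \<ominus> x = (- 1) \<odot> x"
  using smult_l_distr[of 1 "- 1" x] M.minus_unique[of "(- 1) \<odot> x" x x]
  by (simp add: M.minus_equality M.a_comm)

lemma add_diff_cancel:
  assumes "x \<in> carrier g" "y \<in> carrier g"
  shows "y \<oplus> (x \<ominus> y) = x"
  using assms by (simp add: M.minus_eq M.a_lcomm[of y x] M.r_neg)

lemma diff_eq_zero_iff:
  assumes "x \<in> carrier g" "y \<in> carrier g"
  shows "x \<ominus> y = \<zero> \<longleftrightarrow> x = y"
  using assms add_diff_cancel[OF assms] by (auto simp: M.minus_eq M.r_neg)

lemma inner_add_left:
  "x \<in> carrier g \<Longrightarrow> y \<in> carrier g \<Longrightarrow> z \<in> carrier g \<Longrightarrow>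
    inner g (x \<oplus> y) z = inner g x z + inner g y z"
  using inner_linear_left[of 1 1 x y z] by simp

lemma inner_smult_left:
  "a \<in> F \<Longrightarrow> x \<in> carrier g \<Longrightarrow> z \<in> carrier g \<Longrightarrow>
    inner g (a \<odot> x) z = a * inner g x z"
  using inner_linear_left[of a 0 x x z] by simp

lemma inner_minus_left:
  "x \<in> carrier g \<Longrightarrow> z \<in> carrier g \<Longrightarrow> inner g (\<ominus> x) z = - inner g x z"
  by (simp add: minus_eq_smult inner_smult_left)

lemma inner_diff_left:
  "x \<in> carrier g \<Longrightarrow> y \<in> carrier g \<Longrightarrow> z \<in> carrier g \<Longrightarrow>
    inner g (x \<ominus> y) z = inner g x z - inner g y z"
  by (simp add: M.minus_eq inner_add_left inner_minus_left)

lemma inner_zero_left [simp]: "z \<in> carrier g \<Longrightarrow> inner g \<zero> z = 0"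
  using inner_smult_left[of 0 z z] by simp

lemma inner_sym_zero:
  "x \<in> carrier g \<Longrightarrow> y \<in> carrier g \<Longrightarrow> inner g x y = 0 \<Longrightarrow> inner g y x = 0"
  using inner_hermitian[of x y] by simp

lemma inner_self_zero_iff: "x \<in> carrier g \<Longrightarrow> inner g x x = 0 \<longleftrightarrow> x = \<zero>"
  using inner_pos[of x] by (cases "x = \<zero>") auto

lemma inner_finsum_left:
  assumes "finite I" "f \<in> I \<rightarrow> carrier g" "z \<in> carrier g"
  shows "inner g (\<Oplus>i\<in>I. f i) z = (\<Sum>i\<in>I. inner g (f i) z)"
  using assms by (induction I rule: finite_induct) (simp_all add: inner_add_left Pi_def)

lemma bracket_add_right:
  "x \<in> carrier g \<Longrightarrow> y \<in> carrier g \<Longrightarrow> z \<in> carrier g \<Longrightarrow>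
    bracket g z (x \<oplus> y) = bracket g z x \<oplus> bracket g z y"
  using bracket_linear_right[of 1 1 x y z] bracket_closed by simp

lemma bracket_add_left:
  "x \<in> carrier g \<Longrightarrow> y \<in> carrier g \<Longrightarrow> z \<in> carrier g \<Longrightarrow>
    bracket g (x \<oplus> y) z = bracket g x z \<oplus> bracket g y z"
  using bracket_linear_left[of 1 1 x y z] bracket_closed by simp

lemma bracket_smult_right:
  "a \<in> F \<Longrightarrow> x \<in> carrier g \<Longrightarrow> z \<in> carrier g \<Longrightarrow>
    bracket g z (a \<odot> x) = a \<odot> bracket g z x"
  using bracket_linear_right[of a 0 x x z] bracket_closed by simp

lemma bracket_zero_right [simp]: "z \<in> carrier g \<Longrightarrow> bracket g z \<zero> = \<zero>"
  using bracket_smult_right[of 0 \<zero> z] bracket_closed[of z \<zero>] by simp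

lemma bracket_anticommute:
  assumes x: "x \<in> carrier g" and y: "y \<in> carrier g"
  shows "bracket g x y = \<ominus> bracket g y x"
proof -
  have "\<zero> = bracket g (x \<oplus> y) (x \<oplus> y)"
    using x y by (simp add: bracket_self)
  also have "\<dots> = bracket g x y \<oplus> bracket g y x"
    using x y by (simp add: bracket_add_left bracket_add_right
        bracket_self[of x] bracket_self[of y] bracket_closed M.a_comm)
  finally show ?thesis
    using x y by (metis M.minus_equality bracket_closed)
qed

lemma bracket_finsum_right:
  assumes "finite I" "f \<in> I \<rightarrow> carrier g" "z \<in> carrier g"
  shows "bracket g z (\<Oplus>i\<in>I. f i) = (\<Oplus>i\<in>I. bracket g z (f i))"
  using assms
  by (induction I rule: finite_induct) (simp_all add: bracket_add_right bracket_closed Pi_def)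

section \<open>Subspaces and orthogonal sets\<close>

abbreviation subspace :: "'v set \<Rightarrow> bool" where
  "subspace h \<equiv> submodule h (scalars F) g"

lemma subspace_carrier: "subspace h \<Longrightarrow> x \<in> h \<Longrightarrow> x \<in> carrier g"
  using submoduleE(1) by blast

lemma subspace_zero: "subspace h \<Longrightarrow> \<zero> \<in> h"
  by (metis subgroup.one_closed submodule.axioms(1) monoid.simps(2))

lemma subspace_add: "subspace h \<Longrightarrow> x \<in> h \<Longrightarrow> y \<in> h \<Longrightarrow> x \<oplus> y \<in> h"
  using submoduleE(5) by blast

lemma subspace_smult: "subspace h \<Longrightarrow> a \<in> F \<Longrightarrow> x \<in> h \<Longrightarrow> a \<odot> x \<in> h"
  using submoduleE(4)[of h a x] by simp

lemma subspace_minus: "subspace h \<Longrightarrow> x \<in> h \<Longrightarrow> \<ominus> x \<in> h"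
  using submoduleE(3) by blast

lemma subspace_diff: "subspace h \<Longrightarrow> x \<in> h \<Longrightarrow> y \<in> h \<Longrightarrow> x \<ominus> y \<in> h"
  by (simp add: M.minus_eq subspace_add subspace_minus)

lemma subspaceI:
  assumes "h \<subseteq> carrier g" "\<zero> \<in> h" "\<And>x y. x \<in> h \<Longrightarrow> y \<in> h \<Longrightarrow> x \<oplus> y \<in> h"
    and "\<And>a x. a \<in> F \<Longrightarrow> x \<in> h \<Longrightarrow> a \<odot> x \<in> h"
  shows "subspace h"
  using assms by (intro submoduleI) (auto simp: minus_eq_smult subset_iff)

lemma subspace_finsum:
  assumes "subspace h" "finite I" "f \<in> I \<rightarrow> h"
  shows "(\<Oplus>i\<in>I. f i) \<in> h"
  using assms(2,3)
proof (induction I rule: finite_induct)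
  case (insert i I)
  then have "f i \<in> h" "f \<in> I \<rightarrow> h" "f i \<in> carrier g" "f \<in> I \<rightarrow> carrier g"
    using assms(1) subspace_carrier by auto
  then show ?case
    using insert assms(1) by (simp add: subspace_add)
qed (simp add: assms(1) subspace_zero)

lemma orth_compl_subspace:
  assumes "h \<subseteq> carrier g"
  shows "subspace (orth_compl g h)"
  using assms
  by (intro subspaceI) (auto simp: orth_compl_def inner_add_left inner_smult_left subset_iff)

lemma subspace_disjoint_orth_compl: "subspace h \<Longrightarrow> x \<in> h \<Longrightarrow> x \<in> orth_compl g h \<Longrightarrow> x = \<zero>"
  by (auto simp: orth_compl_def inner_self_zero_iff)

definition orthogonal_set :: "'v set \<Rightarrow> bool" where
  "orthogonal_set E \<longleftrightarrow>
    E \<subseteq> carrier g - {\<zero>} \<and> (\<forall>x\<in>E. \<forall>y\<in>E. x \<noteq> y \<longrightarrow> inner g x y = 0)"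

text \<open>
  The vectors of an orthogonal set need not have length one, since \<open>F\<close> may lack the square roots that
  normalising requires; dividing by \<open>inner g e e\<close> keeps every coefficient inside \<open>F\<close>.
\<close>

definition orthogonal_projection :: "'v set \<Rightarrow> 'v \<Rightarrow> 'v" where
  "orthogonal_projection E x = (\<Oplus>e\<in>E. (inner g x e / inner g e e) \<odot> e)"

lemma coefficient_in: "x \<in> carrier g \<Longrightarrow> e \<in> carrier g \<Longrightarrow> inner g x e / inner g e e \<in> F"
  by (simp add: inner_closed)

lemma projection_in_subspace:
  assumes "subspace h" "finite E" "E \<subseteq> h" "x \<in> carrier g"
  shows "orthogonal_projection E x \<in> h"
  unfolding orthogonal_projection_def using assms
  by (intro subspace_finsum) (auto intro!: subspace_smult coefficient_in intro: subspace_carrier)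

lemma inner_projection:
  assumes E: "orthogonal_set E" "finite E" and "x \<in> carrier g" "e \<in> E"
  shows "inner g (orthogonal_projection E x) e = inner g x e"
proof -
  have sub: "e' \<in> carrier g" if "e' \<in> E" for e'
    using E that by (auto simp: orthogonal_set_def)
  have "inner g (orthogonal_projection E x) e
      = (\<Sum>e'\<in>E. inner g x e' / inner g e' e' * inner g e' e)"
    unfolding orthogonal_projection_def using assms sub
    by (subst inner_finsum_left)
      (auto intro!: sum.cong simp: inner_smult_left coefficient_in simp del: times_divide_eq_left)
  also have "\<dots> = (\<Sum>e'\<in>E. if e' = e then inner g x e else 0)"
    using assms by (intro sum.cong) (auto simp: orthogonal_set_def inner_self_zero_iff)
  also have "\<dots> = inner g x e"
    using assms by simp
  finally show ?thesis .
qed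

end

section \<open>Orthogonal projection in finite dimension\<close>

locale finite_dim_metric_lie_algebra = metric_lie_algebra F g
  for F :: "complex set" and g :: "('v, 'e) metric_lie_scheme" (structure) +
  assumes finite_dim: "finite_dim F g"
begin

text \<open>
  Coordinates with respect to a finite spanning set \<open>B\<close> send an orthogonal set \<open>E\<close> to functions
  supported on \<open>B\<close>. For each \<open>e \<in> E\<close>, the linear functional \<open>inner g _ e\<close> lifts to these functions
  and vanishes on the images of all other members of \<open>E\<close> but not on the image of \<open>e\<close>. So the images
  are linearly independent, even over the complex numbers, in a space spanned by \<open>card B\<close> vectors.
\<close>

lemma orthogonal_set_bound:
  obtains n where "\<And>E. orthogonal_set E \<Longrightarrow> finite E \<and> card E \<le> n"
proof -
  obtain B where B: "finite B" "B \<subseteq> carrier g"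
    and span: "\<And>x. x \<in> carrier g \<Longrightarrow> \<exists>c\<in>B \<rightarrow> F. x = (\<Oplus>b\<in>B. c b \<odot> b)"
    using finite_dim unfolding finite_dim_def by blast
  interpret V: vector_space "\<lambda>(a::complex) (v::'v \<Rightarrow> complex) b. a * v b"
    by unfold_locales (auto simp: fun_eq_iff algebra_simps)
  \<comment> \<open>Coordinates need not be unique, as \<open>B\<close> only spans; any choice of them serves.\<close>
  define coord where "coord x = (SOME c. c \<in> B \<rightarrow> F \<and> x = (\<Oplus>b\<in>B. c b \<odot> b))" for x
  define coords where "coords x = (\<lambda>b. if b \<in> B then coord x b else 0)" for x
  have coord: "coord x \<in> B \<rightarrow> F" "x = (\<Oplus>b\<in>B. coord x b \<odot> b)" if "x \<in> carrier g" for x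
    using someI_ex[of "\<lambda>c. c \<in> B \<rightarrow> F \<and> x = (\<Oplus>b\<in>B. c b \<odot> b)"] span[OF that]
    unfolding coord_def by blast+
  define \<delta> :: "'v \<Rightarrow> 'v \<Rightarrow> complex" where "\<delta> b = (\<lambda>b'. if b' = b then 1 else 0)" for b
  define L where "L e v = (\<Sum>b\<in>B. v b * inner g b e)" for e and v :: "'v \<Rightarrow> complex"
  have L: "L e (coords x) = inner g x e" if "x \<in> carrier g" "e \<in> carrier g" for x e
  proof -
    have "inner g x e = inner g (\<Oplus>b\<in>B. coord x b \<odot> b) e"
      using coord(2)[OF that(1)] by simp
    also have "\<dots> = (\<Sum>b\<in>B. inner g (coord x b \<odot> b) e)"
      using coord(1)[OF that(1)] B that by (intro inner_finsum_left) (auto simp: Pi_def subset_iff)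
    also have "\<dots> = (\<Sum>b\<in>B. coord x b * inner g b e)"
      using coord(1)[OF that(1)] B that
      by (intro sum.cong inner_smult_left) (auto simp: Pi_def subset_iff)
    finally show ?thesis
      by (simp add: L_def coords_def)
  qed
  have sum_apply: "(\<Sum>i\<in>I. f i) b = (\<Sum>i\<in>I. f i b)" for f :: "'i \<Rightarrow> 'v \<Rightarrow> complex" and I b
    by (induction I rule: infinite_finite_induct) auto
  have "finite E \<and> card E \<le> card B" if E: "orthogonal_set E" for E
  proof -
    have sub: "e \<in> carrier g" if "e \<in> E" for e
      using E that by (auto simp: orthogonal_set_def)
    have inj: "inj_on coords E"
    proof (rule inj_onI)
      fix e e' assume "e \<in> E" "e' \<in> E" "coords e = coords e'"
      then have "inner g e e' = inner g e' e'"
        using L sub by metis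
      then show "e = e'"
        using E \<open>e \<in> E\<close> \<open>e' \<in> E\<close> sub
        by (auto simp: orthogonal_set_def inner_self_zero_iff)
    qed
    have "V.independent (coords ` E)"
      unfolding V.independent_explicit_finite_subsets
    proof (intro allI impI ballI)
      fix S u v
      assume S: "S \<subseteq> coords ` E" "finite S" "(\<Sum>v\<in>S. (\<lambda>b. u v * v b)) = 0" "v \<in> S"
      obtain e where e: "e \<in> E" "v = coords e"
        using S by blast
      have "0 = L e (\<Sum>v\<in>S. (\<lambda>b. u v * v b))"
        unfolding S(3) by (simp add: L_def)
      also have "\<dots> = (\<Sum>w\<in>S. u w * L e w)"
        unfolding L_def sum_apply sum_distrib_left sum_distrib_right
        by (subst sum.swap) (simp add: mult.assoc)
      also have "\<dots> = (\<Sum>w\<in>S. if w = v then u v * inner g e e else 0)"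
      proof (intro sum.cong refl)
        fix w assume "w \<in> S"
        then obtain e' where e': "e' \<in> E" "w = coords e'"
          using S by blast
        show "u w * L e w = (if w = v then u v * inner g e e else 0)"
        proof (cases "e' = e")
          case False
          then have "w \<noteq> v"
            using inj e e' by (auto dest: inj_onD)
          then show ?thesis
            using E False e e' L sub by (simp add: orthogonal_set_def)
        qed (use e e' L sub in auto)
      qed
      also have "\<dots> = u v * inner g e e"
        using S by simp
      finally show "u v = 0"
        using E e sub by (auto simp: orthogonal_set_def inner_self_zero_iff)
    qed
    moreover have "coords ` E \<subseteq> V.span (\<delta> ` B)"
    proof safe
      fix e
      have "coords e = (\<Sum>b\<in>B. (\<lambda>b'. coord e b * \<delta> b b'))"
        using B by (auto simp: fun_eq_iff sum_apply coords_def \<delta>_def if_distrib cong: if_cong)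
      also have "\<dots> \<in> V.span (\<delta> ` B)"
        by (intro V.span_sum V.span_scale V.span_base) auto
      finally show "coords e \<in> V.span (\<delta> ` B)" .
    qed
    ultimately have "finite (coords ` E) \<and> card (coords ` E) \<le> card (\<delta> ` B)"
      using B by (intro V.independent_span_bound) auto
    then show ?thesis
      using inj card_image_le[OF B(1), of \<delta>] by (auto simp: card_image dest: finite_imageD)
  qed
  then show ?thesis
    using that by blast
qed

text \<open>
  Take an orthogonal set in \<open>h\<close> of the largest possible size: if projecting some \<open>x \<in> h\<close> left a
  non-zero remainder, that remainder would enlarge the set. This also shows that subspaces, for
  which no finite spanning set is given, are finite-dimensional.
\<close>

lemma orthogonal_basis:
  assumes h: "subspace h"
  obtains E where "orthogonal_set E" "finite E" "E \<subseteq> h"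
    and "\<And>x. x \<in> h \<Longrightarrow> orthogonal_projection E x = x"
proof -
  obtain n where n: "\<And>E. orthogonal_set E \<Longrightarrow> finite E \<and> card E \<le> n"
    using orthogonal_set_bound by blast
  let ?P = "\<lambda>E. orthogonal_set E \<and> E \<subseteq> h"
  have "?P {}"
    by (simp add: orthogonal_set_def)
  then obtain E where E: "?P E" and max: "\<And>E'. ?P E' \<Longrightarrow> card E' \<le> card E"
    using ex_has_greatest_nat[of ?P "{}" card "Suc n"] n
    by (meson le_imp_less_Suc)
  have fin: "finite E"
    using E n by blast
  have "orthogonal_projection E x = x" if x: "x \<in> h" for x
  proof (rule ccontr)
    define r where "r = x \<ominus> orthogonal_projection E x"
    assume ne: "orthogonal_projection E x \<noteq> x"
    have xc: "x \<in> carrier g"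
      using h x subspace_carrier by blast
    have p: "orthogonal_projection E x \<in> h"
      using projection_in_subspace h fin E xc by blast
    then have pc: "orthogonal_projection E x \<in> carrier g"
      using h subspace_carrier by blast
    have r: "r \<in> h" "r \<in> carrier g" "r \<noteq> \<zero>"
      unfolding r_def using subspace_diff[OF h x p] xc pc ne
      by (simp_all add: diff_eq_zero_iff eq_commute[of x])
    have Ec: "e \<in> carrier g" if "e \<in> E" for e
      using E that by (auto simp: orthogonal_set_def)
    have re: "inner g r e = 0" "inner g e r = 0" if "e \<in> E" for e
    proof -
      show "inner g r e = 0"
        using inner_projection[of E x e] E fin xc pc Ec that by (simp add: r_def inner_diff_left)
      then show "inner g e r = 0"
        using inner_sym_zero r Ec that by blast
    qed
    have "r \<notin> E"
      using re(1)[of r] r by (auto simp: inner_self_zero_iff)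
    moreover have "?P (insert r E)"
      using E r re by (auto simp: orthogonal_set_def)
    ultimately show False
      using max[of "insert r E"] fin by simp
  qed
  then show ?thesis
    using that E fin by blast
qed

lemma orthogonal_split:
  assumes h: "subspace h" and x: "x \<in> carrier g"
  obtains u v where "u \<in> h" "v \<in> orth_compl g h" "x = u \<oplus> v"
proof -
  obtain E where E: "orthogonal_set E" "finite E" "E \<subseteq> h"
    and basis: "\<And>y. y \<in> h \<Longrightarrow> orthogonal_projection E y = y"
    using orthogonal_basis[OF h] by blast
  define u where "u = orthogonal_projection E x"
  have u: "u \<in> h"
    using projection_in_subspace h E x by (simp add: u_def)
  then have uc: "u \<in> carrier g"
    using h subspace_carrier by blast
  have Ec: "e \<in> carrier g" if "e \<in> E" for e
    using E that by (auto simp: orthogonal_set_def)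
  have "inner g (x \<ominus> u) y = 0" if y: "y \<in> h" for y
  proof -
    have yc: "y \<in> carrier g"
      using h y subspace_carrier by blast
    have "inner g e (x \<ominus> u) = 0" if "e \<in> E" for e
    proof (rule inner_sym_zero)
      show "inner g (x \<ominus> u) e = 0"
        using inner_projection[OF E(1,2) x that] uc x Ec that
        by (simp add: inner_diff_left u_def)
    qed (use uc x Ec that in auto)
    then have "inner g (orthogonal_projection E y) (x \<ominus> u) = 0"
      unfolding orthogonal_projection_def using E x uc yc Ec
      by (subst inner_finsum_left)
        (auto intro!: sum.neutral simp: inner_smult_left coefficient_in
          simp del: times_divide_eq_left)
    then have "inner g y (x \<ominus> u) = 0"
      using basis y by simp
    then show ?thesis
      using inner_sym_zero x uc yc by simp
  qed
  then have "x \<ominus> u \<in> orth_compl g h"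
    using x uc by (simp add: orth_compl_def)
  moreover have "x = u \<oplus> (x \<ominus> u)"
    using add_diff_cancel x uc by simp
  ultimately show ?thesis
    using that u by blast
qed

lemma orth_compl_orth_compl:
  assumes h: "subspace h"
  shows "orth_compl g (orth_compl g h) = h"
proof
  show "h \<subseteq> orth_compl g (orth_compl g h)"
    using subspace_carrier[OF h] by (auto simp: orth_compl_def intro: inner_sym_zero)
  show "orth_compl g (orth_compl g h) \<subseteq> h"
  proof
    fix x assume x: "x \<in> orth_compl g (orth_compl g h)"
    then have "x \<in> carrier g"
      by (simp add: orth_compl_def)
    then obtain u v where uv: "u \<in> h" "v \<in> orth_compl g h" "x = u \<oplus> v"
      using orthogonal_split[OF h] by blast
    have c: "u \<in> carrier g" "v \<in> carrier g"
      using uv h subspace_carrier by (auto simp: orth_compl_def)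
    have "inner g x v = 0" "inner g u v = 0"
      using x uv c by (auto simp: orth_compl_def intro: inner_sym_zero)
    then have "v = \<zero>"
      using uv(3) c by (simp add: inner_add_left inner_self_zero_iff)
    then show "x \<in> h"
      using uv c by simp
  qed
qed

text \<open>
  The adjoint of \<open>bracket g x _\<close> applied to \<open>y\<close>: its coordinates in an orthogonal basis are forced
  by testing against the basis vectors, and linearity extends the identity to all of \<open>g\<close>.
\<close>

lemma adjoint_exists:
  assumes x: "x \<in> carrier g" and y: "y \<in> carrier g"
  obtains w where "w \<in> carrier g" "\<And>z. z \<in> carrier g \<Longrightarrow> inner g (bracket g x z) y = inner g z w"
proof -
  obtain E where E: "orthogonal_set E" "finite E" "E \<subseteq> carrier g"
    and basis: "\<And>z. z \<in> carrier g \<Longrightarrow> orthogonal_projection E z = z"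
    using orthogonal_basis[of "carrier g"] carrier_is_submodule by blast
  define w where "w = (\<Oplus>e\<in>E. (inner g y (bracket g x e) / inner g e e) \<odot> e)"
  have Ec: "e \<in> carrier g" if "e \<in> E" for e
    using E that by auto
  have coeff: "inner g y (bracket g x e) / inner g e e \<in> F" if "e \<in> E" for e
    using x y Ec that by (simp add: inner_closed bracket_closed)
  have w: "w \<in> carrier g"
    unfolding w_def using Ec coeff by (intro M.finsum_closed) auto
  have wE: "inner g e w = inner g (bracket g x e) y" if e: "e \<in> E" for e
  proof -
    have "inner g w e = (\<Sum>e'\<in>E. inner g y (bracket g x e') / inner g e' e' * inner g e' e)"
      unfolding w_def using Ec coeff E e
      by (subst inner_finsum_left)
        (auto intro!: sum.cong simp: inner_smult_left simp del: times_divide_eq_left)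
    also have "\<dots> = (\<Sum>e'\<in>E. if e' = e then inner g y (bracket g x e) else 0)"
      using E e by (intro sum.cong) (auto simp: orthogonal_set_def inner_self_zero_iff)
    also have "\<dots> = inner g y (bracket g x e)"
      using E e by simp
    finally show ?thesis
      using inner_hermitian[of w e] inner_hermitian[of y "bracket g x e"] w x y Ec e bracket_closed
      by simp
  qed
  have "inner g (bracket g x z) y = inner g z w" if z: "z \<in> carrier g" for z
  proof -
    let ?c = "\<lambda>e. inner g z e / inner g e e"
    have c: "?c e \<in> F" if "e \<in> E" for e
      using coefficient_in z Ec that by blast
    have z_eq: "z = (\<Oplus>e\<in>E. ?c e \<odot> e)"
      using basis[OF z] by (simp add: orthogonal_projection_def)
    have "bracket g x z = (\<Oplus>e\<in>E. bracket g x (?c e \<odot> e))"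
      by (subst z_eq) (use E c Ec x in \<open>auto intro!: bracket_finsum_right\<close>)
    then have "inner g (bracket g x z) y = (\<Sum>e\<in>E. inner g (bracket g x (?c e \<odot> e)) y)"
      using E c Ec x y by (simp add: inner_finsum_left bracket_closed Pi_def)
    also have "\<dots> = (\<Sum>e\<in>E. inner g (?c e \<odot> e) w)"
    proof (rule sum.cong[OF refl])
      fix e assume "e \<in> E"
      then show "inner g (bracket g x (?c e \<odot> e)) y = inner g (?c e \<odot> e) w"
        using c[of e] Ec[of e] x y w wE[of e]
        by (simp add: bracket_smult_right inner_smult_left bracket_closed del: times_divide_eq_left)
    qed
    also have "\<dots> = inner g (\<Oplus>e\<in>E. ?c e \<odot> e) w"
      using E c Ec w by (simp add: inner_finsum_left Pi_def)
    finally show ?thesis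
      using z_eq by simp
  qed
  then show ?thesis
    using that w by blast
qed

section \<open>Factors\<close>

abbreviation factor :: "'v set \<Rightarrow> bool" where
  "factor h \<equiv> lie_factor F g h"

lemma factor_subspace: "factor h \<Longrightarrow> subspace h"
  by (simp add: lie_factor_def lie_ideal_def)

lemma factor_bracket: "factor h \<Longrightarrow> x \<in> carrier g \<Longrightarrow> y \<in> h \<Longrightarrow> bracket g x y \<in> h"
  by (simp add: lie_factor_def lie_ideal_def)

lemma ideal_bracket_right:
  assumes "lie_ideal F g h" "x \<in> h" "y \<in> carrier g"
  shows "bracket g x y \<in> h"
  using assms bracket_anticommute[of x y] subspace_carrier[of h x] subspace_minus
  by (simp add: lie_ideal_def)

lemma orth_compl_factor: "factor h \<Longrightarrow> factor (orth_compl g h)"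
  using orth_compl_orth_compl[OF factor_subspace] by (simp add: lie_factor_def)

text \<open>
  The orthogonal complement of a subspace is invariant under an operator exactly if the subspace is
  invariant under the adjoint operator. Hence being a factor is invariance under a fixed family
  of operators, the \<open>bracket g x _\<close> and their adjoints, which makes factors closed under
  arbitrary intersections. The adjoint enters as a relation between \<open>y\<close> and its image \<open>w\<close>.
\<close>

lemma factor_iff_adjoint:
  "factor h \<longleftrightarrow> lie_ideal F g h \<and>
    (\<forall>x\<in>carrier g. \<forall>y\<in>h. \<forall>w\<in>carrier g.
      (\<forall>z\<in>carrier g. inner g (bracket g x z) y = inner g z w) \<longrightarrow> w \<in> h)"
  (is "_ \<longleftrightarrow> _ \<and> ?adj")
proof safe
  assume h: "factor h"
  then show "lie_ideal F g h"
    by (simp add: lie_factor_def)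
  fix x y w
  assume x: "x \<in> carrier g" and y: "y \<in> h" and w: "w \<in> carrier g"
    and adj: "\<forall>z\<in>carrier g. inner g (bracket g x z) y = inner g z w"
  have "inner g w z = 0" if z: "z \<in> orth_compl g h" for z
  proof -
    have zc: "z \<in> carrier g"
      using z by (simp add: orth_compl_def)
    have "inner g (bracket g x z) y = 0"
      using factor_bracket[OF orth_compl_factor[OF h] x z] y by (simp add: orth_compl_def)
    then show ?thesis
      using adj zc w inner_sym_zero by simp
  qed
  then have "w \<in> orth_compl g (orth_compl g h)"
    using w by (simp add: orth_compl_def[of g "orth_compl g h"])
  then show "w \<in> h"
    using orth_compl_orth_compl[OF factor_subspace[OF h]] by simp
next
  assume h: "lie_ideal F g h" and adj: ?adj
  have sub: "subspace h"
    using h by (simp add: lie_ideal_def)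
  have "bracket g x y \<in> orth_compl g h" if x: "x \<in> carrier g" and y: "y \<in> orth_compl g h" for x y
  proof -
    have yc: "y \<in> carrier g"
      using y by (simp add: orth_compl_def)
    have "inner g (bracket g x y) z = 0" if z: "z \<in> h" for z
    proof -
      obtain w where "w \<in> carrier g"
        and w: "\<And>z'. z' \<in> carrier g \<Longrightarrow> inner g (bracket g x z') z = inner g z' w"
        using adjoint_exists[OF x subspace_carrier[OF sub z]] by blast
      then have "w \<in> h"
        using adj x z by blast
      then show ?thesis
        using w[OF yc] y by (simp add: orth_compl_def)
    qed
    then show ?thesis
      using x yc by (simp add: orth_compl_def bracket_closed)
  qed
  moreover have "subspace (orth_compl g h)"
    using sub subspace_carrier by (intro orth_compl_subspace) blast
  ultimately show "factor h"
    using h by (simp add: lie_factor_def lie_ideal_def)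
qed

lemma Inter_factor:
  assumes fac: "\<And>h. h \<in> H \<Longrightarrow> factor h"
  shows "factor (carrier g \<inter> \<Inter>H)"
proof -
  have "subspace (carrier g \<inter> \<Inter>H)"
    using factor_subspace[OF fac]
    by (intro subspaceI) (auto intro: subspace_zero subspace_add subspace_smult)
  then have "lie_ideal F g (carrier g \<inter> \<Inter>H)"
    using fac factor_bracket by (auto simp: lie_ideal_def bracket_closed)
  moreover have "w \<in> carrier g \<inter> \<Inter>H"
    if "x \<in> carrier g" "y \<in> carrier g \<inter> \<Inter>H" "w \<in> carrier g"
      "\<forall>z\<in>carrier g. inner g (bracket g x z) y = inner g z w" for x y w
    using that fac unfolding factor_iff_adjoint by blast
  ultimately show ?thesis
    unfolding factor_iff_adjoint by blast
qed

lemma Int_factor: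
  assumes "factor h" "factor k"
  shows "factor (h \<inter> k)"
proof -
  have "carrier g \<inter> \<Inter>{h, k} = h \<inter> k"
    using assms factor_subspace subspace_carrier by blast
  then show ?thesis
    using Inter_factor[of "{h, k}"] assms by auto
qed

lemma factor_zero: "factor h \<Longrightarrow> \<zero> \<in> h"
  using factor_subspace subspace_zero by blast

lemma factor_commutes_with_orth_compl:
  assumes h: "factor h" and x: "x \<in> h" and y: "y \<in> orth_compl g h"
  shows "bracket g x y = \<zero>"
proof -
  have c: "x \<in> carrier g" "y \<in> carrier g"
    using y subspace_carrier[OF factor_subspace[OF h] x] by (auto simp: orth_compl_def)
  have "bracket g x y \<in> h" "bracket g x y \<in> orth_compl g h"
    using h x y c ideal_bracket_right factor_bracket[OF orth_compl_factor]
    by (auto simp: lie_factor_def)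
  then show ?thesis
    using subspace_disjoint_orth_compl factor_subspace[OF h] by blast
qed

text \<open>
  Since \<open>g\<close> is the sum of \<open>h\<close> and its complement, and the complement acts trivially on \<open>h\<close>, an
  ideal of the Lie algebra \<open>h\<close> is already an ideal of \<open>g\<close>.
\<close>

lemma ideal_of_factor:
  assumes h: "factor h" and k: "subspace k" "k \<subseteq> h"
    and br: "\<And>x y. x \<in> h \<Longrightarrow> y \<in> k \<Longrightarrow> bracket g x y \<in> k"
  shows "lie_ideal F g k"
  unfolding lie_ideal_def
proof (intro conjI ballI k)
  fix x y assume x: "x \<in> carrier g" and y: "y \<in> k"
  obtain u v where uv: "u \<in> h" "v \<in> orth_compl g h" "x = u \<oplus> v"
    using orthogonal_split[OF factor_subspace[OF h] x] by blast
  have c: "u \<in> carrier g" "v \<in> carrier g" "y \<in> carrier g"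
    using uv(2) subspace_carrier[OF factor_subspace[OF h]] uv(1) y k(2) by (auto simp: orth_compl_def)
  have "bracket g v y = \<zero>"
    using factor_commutes_with_orth_compl[OF h _ uv(2)] y k(2) bracket_anticommute[of v y] c by auto
  then have "bracket g x y = bracket g u y"
    using uv(3) c by (simp add: bracket_add_left bracket_closed)
  then show "bracket g x y \<in> k"
    using br uv(1) y by simp
qed

lemma orth_compl_restrict: "h \<subseteq> carrier g \<Longrightarrow> orth_compl (g\<lparr>carrier := h\<rparr>) k = h \<inter> orth_compl g k"
  by (auto simp: orth_compl_def)

lemma submodule_restrict:
  assumes "subspace h"
  shows "submodule k (scalars F) (g\<lparr>carrier := h\<rparr>) \<longleftrightarrow> subspace k \<and> k \<subseteq> h"
proof -
  interpret H: module "scalars F" "g\<lparr>carrier := h\<rparr>"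
    using submodule.submodule_is_module[OF assms] module_axioms by blast
  show ?thesis
  proof
    assume k: "submodule k (scalars F) (g\<lparr>carrier := h\<rparr>)"
    have "k \<subseteq> h"
      using H.submoduleE(1)[OF k] by simp
    moreover have "\<zero> \<in> k"
      using subgroup.one_closed[OF submodule.axioms(1)[OF k]] by simp
    ultimately show "subspace k \<and> k \<subseteq> h"
      using H.submoduleE(4,5)[OF k] subspace_carrier[OF assms] by (auto intro!: subspaceI)
  next
    assume k: "subspace k \<and> k \<subseteq> h"
    have "module (scalars F) (g\<lparr>carrier := k\<rparr>)"
      using submodule.submodule_is_module[of k "scalars F" g] k module_axioms by blast
    then show "submodule k (scalars F) (g\<lparr>carrier := h\<rparr>)"
      using k by (intro H.module_incl_imp_submodule) simp_all
  qed
qed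

lemma ideal_restrict:
  assumes "subspace h"
  shows "lie_ideal F (g\<lparr>carrier := h\<rparr>) k \<longleftrightarrow>
    subspace k \<and> k \<subseteq> h \<and> (\<forall>x\<in>h. \<forall>y\<in>k. bracket g x y \<in> k)"
  using submodule_restrict[OF assms] by (auto simp: lie_ideal_def)

text \<open>
  This turns irreducibility of the Lie algebra \<open>h\<close>, a property of the factors of \<open>h\<close>, into
  minimality of \<open>h\<close> among the factors of \<open>g\<close>. The complement of \<open>k\<close> in \<open>g\<close> is the sum of its
  complement in \<open>h\<close> and the complement of \<open>h\<close>; both are ideals of \<open>g\<close>.
\<close>

lemma factor_restrict:
  assumes h: "factor h"
  shows "lie_factor F (g\<lparr>carrier := h\<rparr>) k \<longleftrightarrow> factor k \<and> k \<subseteq> h"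
proof
  note sub = factor_subspace[OF h]
  have hc: "h \<subseteq> carrier g"
    using subspace_carrier[OF sub] by blast
  {
    assume k: "factor k \<and> k \<subseteq> h"
    have hk: "factor (h \<inter> orth_compl g k)"
      using Int_factor h orth_compl_factor k by blast
    show "lie_factor F (g\<lparr>carrier := h\<rparr>) k"
      unfolding lie_factor_def ideal_restrict[OF sub] orth_compl_restrict[OF hc]
      using k hk hc factor_subspace factor_bracket by blast
  }
  assume "lie_factor F (g\<lparr>carrier := h\<rparr>) k"
  then have k: "subspace k" "k \<subseteq> h" "\<And>x y. x \<in> h \<Longrightarrow> y \<in> k \<Longrightarrow> bracket g x y \<in> k"
    and k': "subspace (h \<inter> orth_compl g k)"
      "\<And>x y. x \<in> h \<Longrightarrow> y \<in> h \<inter> orth_compl g k \<Longrightarrow> bracket g x y \<in> h \<inter> orth_compl g k"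
    unfolding lie_factor_def ideal_restrict[OF sub] orth_compl_restrict[OF hc] by blast+
  have ideal_k: "lie_ideal F g k"
    using ideal_of_factor[OF h] k by blast
  have ideal_k': "lie_ideal F g (h \<inter> orth_compl g k)"
    using ideal_of_factor[OF h k'(1) _ k'(2)] by blast
  have perp_sub: "subspace (orth_compl g k)"
    using k(2) hc by (intro orth_compl_subspace) blast
  have perp_mono: "orth_compl g h \<subseteq> orth_compl g k"
    using k(2) by (auto simp: orth_compl_def)
  have "bracket g x y \<in> orth_compl g k" if x: "x \<in> carrier g" and y: "y \<in> orth_compl g k" for x y
  proof -
    have yc: "y \<in> carrier g"
      using y by (simp add: orth_compl_def)
    obtain u v where uv: "u \<in> h" "v \<in> orth_compl g h" "y = u \<oplus> v"
      using orthogonal_split[OF sub yc] by blast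
    have c: "u \<in> carrier g" "v \<in> carrier g"
      using uv hc by (auto simp: orth_compl_def)
    have "u = y \<ominus> v"
      using uv(3) c by (simp add: M.minus_eq M.a_assoc M.r_neg)
    then have "u \<in> h \<inter> orth_compl g k"
      using subspace_diff[OF perp_sub y] perp_mono uv by blast
    then have "bracket g x u \<in> orth_compl g k"
      using ideal_k' x by (simp add: lie_ideal_def)
    moreover have "bracket g x v \<in> orth_compl g k"
      using factor_bracket[OF orth_compl_factor[OF h] x uv(2)] perp_mono by blast
    ultimately show ?thesis
      using uv(3) c x subspace_add[OF perp_sub] by (simp add: bracket_add_right)
  qed
  then show "factor k \<and> k \<subseteq> h"
    using ideal_k perp_sub k(2) by (simp add: lie_factor_def lie_ideal_def)
qed

section \<open>Minimal factors\<close>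

definition atom :: "'v set \<Rightarrow> bool" where
  "atom h \<longleftrightarrow> factor h \<and> h \<noteq> {\<zero>} \<and> (\<forall>k. factor k \<and> k \<subseteq> h \<longrightarrow> k = {\<zero>} \<or> k = h)"

lemma irreducible_iff_atom:
  "factor h \<and> irreducible_lie F (g\<lparr>carrier := h\<rparr>) \<longleftrightarrow> atom h"
  using factor_restrict[of h] by (auto simp: irreducible_lie_def atom_def)

lemma orth_compl_strict_factor:
  assumes "factor h" "factor k" "h \<subset> k"
  shows "\<exists>x\<in>k \<inter> orth_compl g h. x \<noteq> \<zero>"
proof -
  obtain y where y: "y \<in> k" "y \<notin> h"
    using assms by blast
  have yc: "y \<in> carrier g"
    using y assms factor_subspace subspace_carrier by blast
  obtain u v where uv: "u \<in> h" "v \<in> orth_compl g h" "y = u \<oplus> v"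
    using orthogonal_split[OF factor_subspace[OF assms(1)] yc] by blast
  have c: "u \<in> carrier g" "v \<in> carrier g"
    using uv subspace_carrier[OF factor_subspace[OF assms(1)]] by (auto simp: orth_compl_def)
  have "v \<noteq> \<zero>"
    using uv y c by auto
  moreover have "v = y \<ominus> u"
    using uv(3) c by (simp add: M.minus_eq M.a_assoc M.r_neg M.a_comm[of u v])
  then have "v \<in> k"
    using subspace_diff[OF factor_subspace[OF assms(2)] y(1)] uv(1) assms(3) by blast
  ultimately show ?thesis
    using uv(2) by blast
qed

text \<open>
  The largest size of an orthogonal subset plays the role of the dimension: it strictly increases
  along proper inclusions of factors, so a non-zero factor of least size inside \<open>m\<close> is an atom.
\<close>

lemma atom_below_factor:
  assumes m: "factor m" "m \<noteq> {\<zero>}"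
  obtains h where "atom h" "h \<subseteq> m"
proof -
  obtain n where n: "\<And>E. orthogonal_set E \<Longrightarrow> finite E \<and> card E \<le> n"
    using orthogonal_set_bound by blast
  define d where "d h = Max (card ` {E. orthogonal_set E \<and> E \<subseteq> h})" for h
  have fin: "finite (card ` {E. orthogonal_set E \<and> E \<subseteq> h})" for h
    by (rule finite_subset[of _ "{..n}"]) (use n in auto)
  have d_mono: "d h < d k" if hk: "factor h" "factor k" "h \<subset> k" for h k
  proof -
    have "orthogonal_set {}"
      by (simp add: orthogonal_set_def)
    then have "d h \<in> card ` {E. orthogonal_set E \<and> E \<subseteq> h}"
      unfolding d_def using fin by (intro Max_in) auto
    then obtain E where E: "orthogonal_set E" "E \<subseteq> h" "card E = d h"
      by auto
    obtain x where x: "x \<in> k" "x \<in> orth_compl g h" "x \<noteq> \<zero>"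
      using orth_compl_strict_factor[OF hk] by blast
    have "x \<in> carrier g"
      using x by (simp add: orth_compl_def)
    moreover have "inner g x e = 0 \<and> inner g e x = 0" if "e \<in> E" for e
      using x E that \<open>x \<in> carrier g\<close> inner_sym_zero[of x e]
      by (auto simp: orth_compl_def orthogonal_set_def)
    ultimately have "orthogonal_set (insert x E)"
      using E x by (auto simp: orthogonal_set_def)
    moreover have "insert x E \<subseteq> k"
      using x E hk by blast
    ultimately have "card (insert x E) \<le> d k"
      unfolding d_def using fin by (intro Max_ge) auto
    moreover have "x \<notin> E"
      using subspace_disjoint_orth_compl[OF factor_subspace[OF hk(1)]] x E by blast
    ultimately show ?thesis
      using n[OF E(1)] E(3) by simp
  qed
  let ?P = "\<lambda>h. factor h \<and> h \<noteq> {\<zero>} \<and> h \<subseteq> m"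
  obtain h where h: "?P h" and min: "\<And>k. ?P k \<Longrightarrow> d h \<le> d k"
    using ex_has_least_nat[of ?P m d] m by blast
  have "k = {\<zero>} \<or> k = h" if "factor k" "k \<subseteq> h" for k
    using d_mono[of k h] min[of k] h that by fastforce
  then have "atom h"
    unfolding atom_def using h by blast
  then show ?thesis
    using that h by blast
qed

text \<open>
  The key step. By minimality, an atom \<open>h\<close> in neither \<open>k\<close> nor its complement meets both only in
  zero. But the bracket of \<open>h\<close> with \<open>k\<close> lies in both ideals, hence vanishes, and so does the bracket
  with the complement of \<open>k\<close>. Then \<open>h\<close> is central, and therefore a non-zero abelian factor.
\<close>

lemma atom_below_factor_or_orth_compl:
  assumes h: "atom h" and k: "factor k"
    and no_abelian: "\<not> (\<exists>h. factor h \<and> h \<noteq> {\<zero>} \<and> abelian_lie (g\<lparr>carrier := h\<rparr>))"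
  shows "h \<subseteq> k \<or> h \<subseteq> orth_compl g k"
proof (rule ccontr)
  assume contra: "\<not> (h \<subseteq> k \<or> h \<subseteq> orth_compl g k)"
  have fh: "factor h"
    using h by (simp add: atom_def)
  have hk: "h \<inter> k = {\<zero>}" "h \<inter> orth_compl g k = {\<zero>}"
    using h contra Int_factor[OF fh k] Int_factor[OF fh orth_compl_factor[OF k]]
    unfolding atom_def by blast+
  have central: "bracket g x y = \<zero>" if x: "x \<in> h" and y: "y \<in> carrier g" for x y
  proof -
    have xc: "x \<in> carrier g"
      using x subspace_carrier[OF factor_subspace[OF fh]] by blast
    obtain u v where uv: "u \<in> k" "v \<in> orth_compl g k" "y = u \<oplus> v"
      using orthogonal_split[OF factor_subspace[OF k] y] by blast
    have c: "u \<in> carrier g" "v \<in> carrier g"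
      using uv subspace_carrier[OF factor_subspace[OF k]] by (auto simp: orth_compl_def)
    have "bracket g x u \<in> h \<inter> k" "bracket g x v \<in> h \<inter> orth_compl g k"
      using ideal_bracket_right[of h] fh x c factor_bracket[OF k xc uv(1)]
        factor_bracket[OF orth_compl_factor[OF k] xc uv(2)]
      by (auto simp: lie_factor_def)
    then show ?thesis
      using hk uv(3) xc c by (simp add: bracket_add_right)
  qed
  have "abelian_lie (g\<lparr>carrier := h\<rparr>)"
    using central subspace_carrier[OF factor_subspace[OF fh]] by (simp add: abelian_lie_def)
  then show False
    using no_abelian h by (auto simp: atom_def)
qed

end

section \<open>The decomposition into minimal factors\<close>

locale metric_lie_algebra_no_abelian_factor = finite_dim_metric_lie_algebra F g
  for F :: "complex set" and g :: "('v, 'e) metric_lie_scheme" (structure) +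
  assumes no_abelian_factor: "\<not> (\<exists>h. lie_factor F g h \<and> h \<noteq> {\<zero>} \<and> abelian_lie (g\<lparr>carrier := h\<rparr>))"
begin

lemma atoms_orthogonal:
  assumes h: "atom h" and k: "atom k" and ne: "h \<noteq> k"
  shows "h \<subseteq> orth_compl g k"
proof -
  have "\<not> h \<subseteq> k"
    using assms by (auto simp: atom_def)
  then show ?thesis
    using atom_below_factor_or_orth_compl[OF h _ no_abelian_factor] k by (auto simp: atom_def)
qed

text \<open>
  Non-zero vectors chosen from distinct atoms form an orthogonal set, whose size is bounded.
\<close>

lemma finite_atoms: "finite {h. atom h}"
proof -
  obtain n where n: "\<And>E. orthogonal_set E \<Longrightarrow> finite E \<and> card E \<le> n"
    using orthogonal_set_bound by blast
  have "\<exists>x. x \<in> h \<and> x \<in> carrier g \<and> x \<noteq> \<zero>" if "atom h" for h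
    using that factor_zero[of h] subspace_carrier[OF factor_subspace[of h]]
    unfolding atom_def by blast
  then obtain p where p: "\<And>h. atom h \<Longrightarrow> p h \<in> h \<and> p h \<in> carrier g \<and> p h \<noteq> \<zero>"
    by metis
  have perp: "inner g (p h) (p k) = 0" if "atom h" "atom k" "h \<noteq> k" for h k
    using atoms_orthogonal[OF that] p that by (auto simp: orth_compl_def)
  have "inj_on p {h. atom h}"
    using perp p by (intro inj_onI) (metis inner_self_zero_iff mem_Collect_eq)
  moreover have "orthogonal_set (p ` {h. atom h})"
    using p perp by (auto simp: orthogonal_set_def)
  ultimately show ?thesis
    using n finite_imageD by blast
qed

text \<open>
  The vectors orthogonal to every atom form a factor. If it were non-zero, it would contain an atom,
  which would then be orthogonal to itself.
\<close>

lemma orthogonal_to_atoms: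
  assumes x: "x \<in> carrier g" and perp: "\<And>h. atom h \<Longrightarrow> x \<in> orth_compl g h"
  shows "x = \<zero>"
proof (rule ccontr)
  assume "x \<noteq> \<zero>"
  define W where "W = carrier g \<inter> \<Inter>(orth_compl g ` {h. atom h})"
  have "factor W"
    unfolding W_def by (rule Inter_factor) (auto simp: atom_def intro: orth_compl_factor)
  moreover have "x \<in> W"
    using x perp by (auto simp: W_def)
  ultimately obtain h where h: "atom h" "h \<subseteq> W"
    using atom_below_factor[of W] \<open>x \<noteq> \<zero>\<close> by blast
  then have "h \<subseteq> orth_compl g h"
    by (auto simp: W_def)
  then have "h \<subseteq> {\<zero>}"
    using subspace_disjoint_orth_compl[OF factor_subspace[of h]] h(1) by (auto simp: atom_def)
  then show False
    using h(1) factor_zero[of h] by (auto simp: atom_def)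
qed

text \<open>
  The members of a decomposition into irreducible factors are atoms. No atom can be missing, because
  it would be orthogonal to all the members and hence to their sum \<open>g\<close>; none can occur twice,
  because it would be orthogonal to itself.
\<close>

lemma decomposition_lists_atoms:
  assumes dec: "irreducible_factor_decomposition F g hs"
  shows "distinct hs \<and> set hs = {h. atom h}"
proof
  have sub: "atom h" if "h \<in> set hs" for h
    using dec that irreducible_iff_atom[of h] by (simp add: irreducible_factor_decomposition_def)
  note od = dec[unfolded irreducible_factor_decomposition_def orthogonal_decomposition_def]
  show "distinct hs"
    unfolding distinct_conv_nth
  proof (intro allI impI)
    fix i j assume ij: "i < length hs" "j < length hs" "i \<noteq> j"
    show "hs ! i \<noteq> hs ! j"
    proof
      assume eq: "hs ! i = hs ! j"
      have a: "atom (hs ! i)"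
        using sub ij by simp
      have "x = \<zero>" if "x \<in> hs ! i" for x
      proof -
        have "inner g x x = 0"
          using od ij eq that by auto
        moreover have "x \<in> carrier g"
          using that a factor_subspace subspace_carrier unfolding atom_def by blast
        ultimately show ?thesis
          by (simp add: inner_self_zero_iff)
      qed
      then show False
        using a factor_zero[of "hs ! i"] unfolding atom_def by blast
    qed
  qed
  show "set hs = {h. atom h}"
  proof (intro equalityI subsetI CollectI)
    fix h assume "h \<in> {h. atom h}"
    then have h: "atom h"
      by simp
    show "h \<in> set hs"
    proof (rule ccontr)
      assume notin: "h \<notin> set hs"
      have "x = \<zero>" if x: "x \<in> h" for x
      proof -
        have xc: "x \<in> carrier g"
          using x h factor_subspace subspace_carrier unfolding atom_def by blast
        then obtain f where f: "f \<in> (\<Pi>\<^sub>E i\<in>{..<length hs}. hs ! i)" "x = (\<Oplus>i\<in>{..<length hs}. f i)"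
          using od[THEN conjunct2, THEN conjunct2, THEN conjunct2, THEN bspec, THEN ex1_implies_ex]
          by blast
        have fi: "inner g (f i) x = 0 \<and> f i \<in> carrier g" if "i < length hs" for i
        proof -
          have "f i \<in> hs ! i" "atom (hs ! i)" "hs ! i \<noteq> h"
            using f that sub notin by (auto dest: nth_mem)
          then show ?thesis
            using atoms_orthogonal[of "hs ! i" h] h x by (auto simp: orth_compl_def)
        qed
        have "inner g x x = (\<Sum>i<length hs. inner g (f i) x)"
          using inner_finsum_left[of "{..<length hs}" f x] fi xc f(2) by auto
        then show ?thesis
          using fi xc by (simp add: inner_self_zero_iff)
      qed
      then show False
        using h factor_zero[of h] unfolding atom_def by blast
    qed
  qed (use sub in auto)
qed

text \<open>
  Subtracting from a vector its projections to all the atoms leaves a vector that is orthogonal to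
  every atom, hence zero; so the atoms span \<open>g\<close>. Orthogonality makes the sum direct.
\<close>

lemma atoms_decompose:
  assumes hs: "distinct hs" "set hs = {h. atom h}"
  shows "irreducible_factor_decomposition F g hs"
proof -
  let ?I = "{..<length hs}"
  have atom: "atom (hs ! i)" if "i < length hs" for i
    using hs that nth_mem by blast
  then have fac: "factor (hs ! i)" if "i < length hs" for i
    using that by (simp add: atom_def)
  have sub: "x \<in> carrier g" if "i < length hs" "x \<in> hs ! i" for i x
    using that fac factor_subspace subspace_carrier by blast
  have perp: "inner g x y = 0"
    if "i < length hs" "j < length hs" "i \<noteq> j" "x \<in> hs ! i" "y \<in> hs ! j" for i j x y
  proof -
    have "hs ! i \<noteq> hs ! j"
      using hs(1) that by (simp add: nth_eq_iff_index_eq)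
    then show ?thesis
      using atoms_orthogonal[OF atom atom, of i j] that by (auto simp: orth_compl_def)
  qed
  have inner_sum: "inner g (\<Oplus>i\<in>?I. f i) y = inner g (f j) y"
    if f: "\<And>i. i < length hs \<Longrightarrow> f i \<in> hs ! i" and j: "j < length hs" "y \<in> hs ! j" for f j y
  proof -
    have "inner g (\<Oplus>i\<in>?I. f i) y = (\<Sum>i\<in>?I. inner g (f i) y)"
      using f sub j by (intro inner_finsum_left) auto
    also have "\<dots> = (\<Sum>i\<in>?I. if i = j then inner g (f j) y else 0)"
      using f perp j by (intro sum.cong) auto
    finally show ?thesis
      using j by simp
  qed
  have "\<exists>!f. f \<in> (\<Pi>\<^sub>E i\<in>?I. hs ! i) \<and> x = (\<Oplus>i\<in>?I. f i)" if x: "x \<in> carrier g" for x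
  proof (rule ex_ex1I)
    have "\<exists>u v. u \<in> hs ! i \<and> v \<in> orth_compl g (hs ! i) \<and> x = u \<oplus> v" if "i < length hs" for i
      by (rule orthogonal_split[OF factor_subspace[OF fac[OF that]] x]) auto
    then obtain u v where uv: "\<And>i. i < length hs \<Longrightarrow>
        u i \<in> hs ! i \<and> v i \<in> orth_compl g (hs ! i) \<and> x = u i \<oplus> v i"
      by metis
    define s where "s = (\<Oplus>i\<in>?I. u i)"
    have s: "s \<in> carrier g"
      unfolding s_def using uv sub by (intro M.finsum_closed) auto
    have "x \<ominus> s = \<zero>"
    proof (rule orthogonal_to_atoms)
      fix h assume "atom h"
      then obtain j where j: "j < length hs" "h = hs ! j"
        using hs(2) by (metis in_set_conv_nth mem_Collect_eq)
      have "inner g (x \<ominus> s) y = 0" if y: "y \<in> h" for y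
      proof -
        have c: "u j \<in> carrier g" "v j \<in> carrier g" "y \<in> carrier g"
          using uv[OF j(1)] sub j y by (auto simp: orth_compl_def)
        have "inner g x y = inner g (u j) y + inner g (v j) y"
          using uv[OF j(1)] c inner_add_left by metis
        also have "inner g (v j) y = 0"
          using uv[OF j(1)] j y by (auto simp: orth_compl_def)
        finally have "inner g x y = inner g s y"
          using inner_sum[of u j y] uv j y by (simp add: s_def)
        then show ?thesis
          using x s c by (simp add: inner_diff_left)
      qed
      then show "x \<ominus> s \<in> orth_compl g h"
        using x s by (simp add: orth_compl_def)
    qed (use x s in simp)
    then have "x = s"
      using x s diff_eq_zero_iff by simp
    moreover have "s = (\<Oplus>i\<in>?I. restrict u ?I i)"
      unfolding s_def using uv sub by (intro M.finsum_cong') auto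
    moreover have "restrict u ?I \<in> (\<Pi>\<^sub>E i\<in>?I. hs ! i)"
      using uv by auto
    ultimately show "\<exists>f. f \<in> (\<Pi>\<^sub>E i\<in>?I. hs ! i) \<and> x = (\<Oplus>i\<in>?I. f i)"
      by metis
  next
    fix f f'
    assume f: "f \<in> (\<Pi>\<^sub>E i\<in>?I. hs ! i) \<and> x = (\<Oplus>i\<in>?I. f i)"
      and f': "f' \<in> (\<Pi>\<^sub>E i\<in>?I. hs ! i) \<and> x = (\<Oplus>i\<in>?I. f' i)"
    have mem: "f i \<in> hs ! i" "f' i \<in> hs ! i" if "i < length hs" for i
      using f f' that by auto
    have "f j = f' j" if j: "j < length hs" for j
    proof -
      have m: "f j \<in> hs ! j" "f' j \<in> hs ! j"
        using mem j by blast+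
      have c: "f j \<in> carrier g" "f' j \<in> carrier g"
        using m sub j by auto
      have d: "f j \<ominus> f' j \<in> hs ! j"
        using subspace_diff factor_subspace fac j m by blast
      have "inner g (f j) (f j \<ominus> f' j) = inner g x (f j \<ominus> f' j)"
        using inner_sum[OF mem(1) j d] f by simp
      also have "\<dots> = inner g (f' j) (f j \<ominus> f' j)"
        using inner_sum[OF mem(2) j d] f' by simp
      finally have "inner g (f j \<ominus> f' j) (f j \<ominus> f' j) = 0"
        using c by (simp add: inner_diff_left)
      then show ?thesis
        using c by (simp add: inner_self_zero_iff diff_eq_zero_iff)
    qed
    then show "f = f'"
      using f f' by (intro PiE_ext[of f ?I "\<lambda>i. hs ! i" f']) auto
  qed
  then have "orthogonal_decomposition F g hs"
    using fac perp by (auto simp: orthogonal_decomposition_def lie_factor_def)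
  then show ?thesis
    using hs(2) irreducible_iff_atom by (simp add: irreducible_factor_decomposition_def)
qed

end

theorem theorem3p1:
  fixes F :: "complex set" and g :: "'v metric_lie"
  assumes "metric_lie_algebra F g"
    and "finite_dim F g"
    and "\<not> (\<exists>h. lie_factor F g h \<and> h \<noteq> {\<zero>\<^bsub>g\<^esub>} \<and> abelian_lie (g\<lparr>carrier := h\<rparr>))"
  shows "\<exists>gs. irreducible_factor_decomposition F g gs \<and>
    (\<forall>hs. irreducible_factor_decomposition F g hs \<longrightarrow> mset hs = mset gs)"
proof -
  interpret metric_lie_algebra_no_abelian_factor F g
    using assms
    by (simp add: metric_lie_algebra_no_abelian_factor_def finite_dim_metric_lie_algebra_def
        finite_dim_metric_lie_algebra_axioms_def metric_lie_algebra_no_abelian_factor_axioms_def)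
  obtain gs where gs: "set gs = {h. atom h}" "distinct gs"
    using finite_distinct_list[OF finite_atoms] by blast
  have "mset hs = mset gs" if "irreducible_factor_decomposition F g hs" for hs
    using decomposition_lists_atoms[OF that] gs by (metis set_eq_iff_mset_eq_distinct)
  then show ?thesis
    using atoms_decompose gs by blast
qed

end
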